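(* Let $p$ be a prime, let $d, w_1, w_2 \in \mathbb{N}$, let $\chi$ be a Dirichlet character with conductor $d$ (with values in $\mathbb{C}_p$), and let $\xi \in T_p$. For all $n \in \mathbb{Z}_+$ and $m \in \mathbb{N}$, $$\sum_{k=0}^{n}\binom{n}{k}w_1^{k-1} w_2^{n-k}B_{n-k,\chi,\xi^{w_2}}^{(m-1)}\sum_{i=0}^{dw_1-1}\chi(i)\xi^{w_2 i}B_{k,\chi,\xi^{w_1}}^{(m)}\!\left(\frac{w_2}{w_1}i\right)$$ $$=\sum_{k=0}^{n}\binom{n}{k}w_2^{k-1} w_1^{n-k}B_{n-k,\chi,\xi^{w_1}}^{(m-1)}\sum_{i=0}^{dw_2-1}\chi(i)\xi^{w_1 i}B_{k,\chi,\xi^{w_2}}^{(m)}\!\left(\frac{w_1}{w_2}i\right).$$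
   Context: $\mathbb{N}=\{1,2,3,\dots\}$ and $\mathbb{Z}_+=\mathbb{N}\cup\{0\}$. $\mathbb{C}_p$ is the completion of an algebraic closure of $\mathbb{Q}_p$. $T_p=\bigcup_{n\ge 1}\{\omega\in\mathbb{C}_p : \omega^{p^n}=1\}$ is the group of $p$-power roots of unity. For $\xi\in T_p$, a Dirichlet character $\chi$ with conductor $d$, and an integer $k\ge 0$, the generalized twisted Bernoulli polynomials of order $k$ attached to $\chi$, $B_{n,\chi,\xi}^{(k)}(x)$, are defined by the identity of formal power series in $t$ $$\left(\frac{t\sum_{a=0}^{d-1}\chi(a)\xi^a e^{at}}{\xi^d e^{dt}-1}\right)^k e^{xt}=\sum_{n=0}^{\infty}B_{n,\chi,\xi}^{(k)}(x)\frac{t^n}{n!}$$ (so for $k=0$ one has $B_{n,\chi,\xi}^{(0)}(x)=x^n$, with $0^0=1$). The generalized twisted Bernoulli numbers of order $k$ attached to $\chi$ are $B_{n,\chi,\xi}^{(k)}=B_{n,\chi,\xi}^{(k)}(0)$. *)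

theory Defs
  imports
    "HOL-Analysis.Abstract_Metric_Spaces"
    "HOL-Algebra.Algebraic_Closure_Type"
    "HOL-Computational_Algebra.Formal_Power_Series"
    "HOL-Number_Theory.Cong"
begin

section \<open>The field \<open>\<complex>\<^sub>p\<close>\<close>

locale ultrametric_field =
  fixes abv :: "'a :: field_char_0 \<Rightarrow> real"
  assumes abv_nonneg: "abv x \<ge> 0"
    and abv_eq_0_iff: "abv x = 0 \<longleftrightarrow> x = 0"
    and abv_mult: "abv (x * y) = abv x * abv y"
    and abv_ultrametric: "abv (x + y) \<le> max (abv x) (abv y)"
begin

lemma abv_one: "abv 1 = 1"
  using abv_mult[of 1 1] abv_eq_0_iff[of 1] by simp

lemma abv_minus: "abv (- x) = abv x"
proof -
  have "abv (-1) * abv (-1) = 1"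
    using abv_mult[of "-1" "-1"] abv_one by simp
  then have "abv (-1) = 1"
    using abv_nonneg[of "-1"] square_eq_1_iff[of "abv (-1)"] by auto
  then show ?thesis
    using abv_mult[of "-1" x] by simp
qed

sublocale Metric_space UNIV "\<lambda>x y. abv (x - y)"
proof
  show "abv (x - y) \<ge> 0" for x y
    by (rule abv_nonneg)
  show "abv (x - y) = abv (y - x)" for x y
    using abv_minus[of "x - y"] by simp
  show "abv (x - y) = 0 \<longleftrightarrow> x = y" for x y
    by (simp add: abv_eq_0_iff)
  show "abv (x - z) \<le> abv (x - y) + abv (y - z)" for x y z
    using abv_ultrametric[of "x - y" "y - z"] abv_nonneg[of "x - y"] abv_nonneg[of "y - z"]
    by simp
qed

end

text \<open>
  \<open>\<complex>\<^sub>p\<close> is characterised up to isometric isomorphism as a completion of an algebraic closure of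
  \<open>\<rat>\<^sub>p\<close>: a complete valued field whose absolute value restricts to the \<open>p\<close>-adic one on \<open>\<rat>\<close>, and
  which contains a dense subfield that is an algebraic closure of \<open>\<rat>\<^sub>p\<close>. Since the
  field is complete, the topological closure of \<open>\<rat>\<close> in it is the completion \<open>\<rat>\<^sub>p\<close>.
\<close>

locale p_adic_complex_field = ultrametric_field abv
  for p :: nat and abv :: "'a :: field_char_0 \<Rightarrow> real" +
  assumes prime_p: "prime p"
    and abv_of_int: "n \<noteq> 0 \<Longrightarrow> abv (of_int n) = (1 / real p) ^ multiplicity (int p) n"
    and complete: "mcomplete"
    and dense_algebraic_closure:
      "\<exists>A. algebraic_closure ((ring_of_type_algebra :: 'a ring)\<lparr>carrier := A\<rparr>) (mtopology closure_of \<rat>)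
           \<and> mtopology closure_of A = UNIV"

definition p_power_roots_of_unity :: "nat \<Rightarrow> 'a :: monoid_mult set" where
  "p_power_roots_of_unity p = (\<Union>n\<in>{1..}. {\<omega>. \<omega> ^ (p ^ n) = 1})"


section \<open>Dirichlet characters\<close>

text \<open>
  With values in a field, multiplicativity and \<open>chi 1 \<noteq> 0\<close> give \<open>chi 1 = 1\<close>.
\<close>

definition dirichlet_character :: "nat \<Rightarrow> (int \<Rightarrow> 'a :: field) \<Rightarrow> bool" where
  "dirichlet_character N chi \<longleftrightarrow>
     N > 0 \<and>
     (\<forall>a b. chi (a * b) = chi a * chi b) \<and>
     (\<forall>a. chi (a + int N) = chi a) \<and>
     (\<forall>a. chi a \<noteq> 0 \<longleftrightarrow> coprime a (int N))"

definition conductor :: "nat \<Rightarrow> (int \<Rightarrow> 'a :: field) \<Rightarrow> nat" where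
  "conductor N chi =
     (LEAST f. f dvd N \<and> (\<forall>a. coprime a (int N) \<and> [a = 1] (mod int f) \<longrightarrow> chi a = 1))"

text \<open>
  A character with conductor \<open>d\<close> is, as usual, taken in its primitive form, i.e.\ with modulus \<open>d\<close>,
  so that \<open>chi a = 0\<close> unless \<open>a\<close> is coprime to \<open>d\<close>.
\<close>

definition dirichlet_character_with_conductor :: "nat \<Rightarrow> (int \<Rightarrow> 'a :: field) \<Rightarrow> bool" where
  "dirichlet_character_with_conductor d chi \<longleftrightarrow> dirichlet_character d chi \<and> conductor d chi = d"


section \<open>Generalized twisted Bernoulli polynomials\<close>

text \<open>
  If \<open>\<xi>\<^sup>d = 1\<close>, the denominator below is not a unit; division of power series then cancels
  the common factor \<open>fps_X\<close>, see \<open>twisted_bernoulli_fps_mult_denominator\<close>.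
\<close>

definition twisted_bernoulli_fps :: "nat \<Rightarrow> (int \<Rightarrow> 'a) \<Rightarrow> 'a \<Rightarrow> 'a :: field_char_0 fps" where
  "twisted_bernoulli_fps d chi \<xi> =
     (fps_X * (\<Sum>a=0..<d. fps_const (chi (int a) * \<xi> ^ a) * fps_exp (of_nat a))) /
     (fps_const (\<xi> ^ d) * fps_exp (of_nat d) - 1)"

lemma twisted_bernoulli_fps_mult_denominator:
  fixes \<xi> :: "'a :: field_char_0"
  assumes "d > 0" and "\<xi> \<noteq> 0"
  shows "twisted_bernoulli_fps d chi \<xi> * (fps_const (\<xi> ^ d) * fps_exp (of_nat d) - 1) =
         fps_X * (\<Sum>a=0..<d. fps_const (chi (int a) * \<xi> ^ a) * fps_exp (of_nat a))"
proof -
  define D where "D = fps_const (\<xi> ^ d) * fps_exp (of_nat d) - 1"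
  define N where "N = fps_X * (\<Sum>a=0..<d. fps_const (chi (int a) * \<xi> ^ a) * fps_exp (of_nat a))"
  have D1: "fps_nth D 1 \<noteq> 0"
    using assms by (simp add: D_def)
  then have "D \<noteq> 0" and "subdegree D \<le> 1"
    by (auto intro: subdegree_leI)
  moreover have "1 \<le> subdegree N" if "N \<noteq> 0"
    using that by (intro subdegree_geI) (auto simp: N_def)
  ultimately have "D dvd N"
    by (cases "N = 0") (auto simp: fps_dvd_iff)
  then show ?thesis
    by (simp add: twisted_bernoulli_fps_def D_def N_def)
qed

definition twisted_bernoulli_poly ::
    "nat \<Rightarrow> (int \<Rightarrow> 'a) \<Rightarrow> 'a \<Rightarrow> nat \<Rightarrow> nat \<Rightarrow> 'a \<Rightarrow> 'a :: field_char_0" where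
  "twisted_bernoulli_poly d chi \<xi> k n x =
     fact n * fps_nth (twisted_bernoulli_fps d chi \<xi> ^ k * fps_exp x) n"

lemma twisted_bernoulli_poly_generating_function:
  "twisted_bernoulli_fps d chi \<xi> ^ k * fps_exp x =
     Abs_fps (\<lambda>n. twisted_bernoulli_poly d chi \<xi> k n x / fact n)"
  by (simp add: twisted_bernoulli_poly_def fps_eq_iff)

definition twisted_bernoulli_number ::
    "nat \<Rightarrow> (int \<Rightarrow> 'a) \<Rightarrow> 'a \<Rightarrow> nat \<Rightarrow> nat \<Rightarrow> 'a :: field_char_0" where
  "twisted_bernoulli_number d chi \<xi> k n = twisted_bernoulli_poly d chi \<xi> k n 0"

end

theory Submission
  imports Defs
begin

text \<open>
  Both sides are \<open>n!\<close> times the \<open>n\<close>-th coefficient of a power series, and the two series agree.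
  Put \<open>A(c, N) = \<Sum>\<^sub>i chi(i) \<xi>\<^bsup>ci\<^esup> e\<^bsup>cit\<^esup>\<close>, summed over \<open>0 \<le> i < N\<close>, put \<open>E = \<xi>\<^bsup>d\<^esup> e\<^bsup>dt\<^esup>\<close>, and let \<open>F\<^sub>w(t)\<close>
  be the series of the Bernoulli numbers of order one attached to \<open>\<xi>\<^bsup>w\<^esup>\<close>, taken at \<open>wt\<close> instead of \<open>t\<close>.
  Multiplying out the binomial convolution (lemma \<open>bernoulli_convolution\<close>), the left-hand side
  is \<open>n!\<close> times the \<open>n\<close>-th coefficient of
  \<open>w1\<^bsup>-1\<^esup> F\<^sub>w\<^sub>1\<^bsup>m\<^esup> F\<^sub>w\<^sub>2\<^bsup>m-1\<^esup> A(w2, d w1)\<close>, and the right-hand side is the same with \<open>w1\<close> and \<open>w2\<close>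
  exchanged. Up to the symmetric factor \<open>(F\<^sub>w\<^sub>1 F\<^sub>w\<^sub>2)\<^bsup>m-1\<^esup> / (w1 w2)\<close>, it remains to see that
  \<open>w2 F\<^sub>w\<^sub>1 A(w2, d w1)\<close> is symmetric in \<open>w1\<close> and \<open>w2\<close>.

  By definition \<open>F\<^sub>w (E\<^bsup>w\<^esup> - 1) = w t A(w, d)\<close>, and since \<open>chi\<close> has period \<open>d\<close>, splitting the
  range of summation into blocks of length \<open>d\<close> gives a geometric sum:
  \<open>A(w2, d w1) (E\<^bsup>w2\<^esup> - 1) = A(w2, d) (E\<^bsup>w1 w2\<^esup> - 1)\<close>. Hence multiplying
  \<open>w2 F\<^sub>w\<^sub>1 A(w2, d w1)\<close> by the nonzero series \<open>(E\<^bsup>w1\<^esup> - 1) (E\<^bsup>w2\<^esup> - 1)\<close> yields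
  \<open>w1 w2 t A(w1, d) A(w2, d) (E\<^bsup>w1 w2\<^esup> - 1)\<close>, which is symmetric, and power series over a field
  form an integral domain. The series \<open>E\<^bsup>w\<^esup> - 1\<close> is nonzero even if \<open>\<xi>\<^bsup>dw\<^esup> = 1\<close>, because its
  coefficient at \<open>t\<close> is \<open>\<xi>\<^bsup>dw\<^esup> dw\<close>, where \<open>\<xi> \<noteq> 0\<close> as a root of unity.
\<close>

text \<open>
  The twisted exponential sum \<open>A(c, N)\<close>: the parameter \<open>c\<close> both replaces \<open>\<xi>\<close> by \<open>\<xi>\<^bsup>c\<^esup>\<close> and
  scales the variable \<open>t\<close>.
\<close>

definition twisted_exp_sum ::
    "(int \<Rightarrow> 'a) \<Rightarrow> 'a \<Rightarrow> nat \<Rightarrow> nat \<Rightarrow> 'a :: field_char_0 fps" where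
  "twisted_exp_sum chi \<xi> c N =
     (\<Sum>i=0..<N. fps_const (chi (int i) * \<xi> ^ (c * i)) * fps_exp (of_nat (c * i)))"

text \<open>The series \<open>\<xi>\<^bsup>c\<^esup> e\<^bsup>ct\<^esup>\<close>, which is the \<open>c\<close>-th power of \<open>\<xi> e\<^bsup>t\<^esup>\<close>.\<close>

definition twisted_exp :: "'a \<Rightarrow> nat \<Rightarrow> 'a :: field_char_0 fps" where
  "twisted_exp \<xi> c = fps_const (\<xi> ^ c) * fps_exp (of_nat c)"

text \<open>The series \<open>F\<^sub>w\<close>: the generating series attached to \<open>\<xi>\<^bsup>w\<^esup>\<close> with \<open>t\<close> replaced by \<open>wt\<close>.\<close>

definition scaled_bernoulli_fps ::
    "nat \<Rightarrow> (int \<Rightarrow> 'a) \<Rightarrow> 'a \<Rightarrow> nat \<Rightarrow> 'a :: field_char_0 fps" where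
  "scaled_bernoulli_fps d chi \<xi> w =
     twisted_bernoulli_fps d chi (\<xi> ^ w) oo (fps_const (of_nat w) * fps_X)"

lemma twisted_exp_add: "twisted_exp \<xi> (a + b) = twisted_exp \<xi> a * twisted_exp \<xi> b"
  by (simp add: twisted_exp_def power_add fps_exp_add_mult mult_ac flip: fps_const_mult)

lemma twisted_exp_power: "twisted_exp \<xi> a ^ j = twisted_exp \<xi> (a * j)"
  by (induction j) (simp_all add: twisted_exp_add, simp add: twisted_exp_def)

lemma twisted_exp_neq_1:
  assumes "c > 0" and "\<xi> \<noteq> 0"
  shows "twisted_exp \<xi> c - 1 \<noteq> 0"
proof -
  have "fps_nth (twisted_exp \<xi> c - 1) 1 \<noteq> 0"
    using assms by (simp add: twisted_exp_def)
  then show ?thesis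
    by auto
qed

lemma twisted_exp_sum_altdef:
  "twisted_exp_sum chi \<xi> c N = (\<Sum>i=0..<N. fps_const (chi (int i)) * twisted_exp \<xi> (c * i))"
  by (simp add: twisted_exp_sum_def twisted_exp_def mult.assoc flip: fps_const_mult)

text \<open>
  The sum over \<open>w\<close> periods of \<open>chi\<close> is the sum over one period times a geometric sum with
  ratio \<open>\<xi>\<^bsup>cd\<^esup> e\<^bsup>cdt\<^esup>\<close>.
\<close>

lemma twisted_exp_sum_mult_period:
  assumes periodic: "\<And>a. chi (a + int d) = chi a"
  shows "twisted_exp_sum chi \<xi> c (d * w) * (twisted_exp \<xi> (c * d) - 1) =
         twisted_exp_sum chi \<xi> c d * (twisted_exp \<xi> (c * d * w) - 1)"
proof -
  have periodic': "chi (int (i + d * w)) = chi (int i)" for i w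
  proof (induction w)
    case (Suc w)
    then show ?case
      using periodic[of "int (i + d * w)"] by (simp add: algebra_simps)
  qed simp
  have "twisted_exp_sum chi \<xi> c (d * w) =
        twisted_exp_sum chi \<xi> c d * (\<Sum>j<w. twisted_exp \<xi> (c * d) ^ j)"
  proof (induction w)
    case 0
    then show ?case by (simp add: twisted_exp_sum_def)
  next
    case (Suc w)
    have "twisted_exp_sum chi \<xi> c (d * Suc w) = twisted_exp_sum chi \<xi> c (d * w) +
            (\<Sum>i=d*w..<d*w+d. fps_const (chi (int i)) * twisted_exp \<xi> (c * i))"
      unfolding twisted_exp_sum_altdef
      by (subst sum.atLeastLessThan_concat) (simp_all add: add.commute)
    also have "(\<Sum>i=d*w..<d*w+d. fps_const (chi (int i)) * twisted_exp \<xi> (c * i)) =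
               (\<Sum>i=0..<d. fps_const (chi (int (i + d * w))) * twisted_exp \<xi> (c * (i + d * w)))"
      using sum.shift_bounds_nat_ivl
        [of "\<lambda>i. fps_const (chi (int i)) * twisted_exp \<xi> (c * i)" 0 "d * w" d]
      by (simp add: add.commute)
    also have "\<dots> = twisted_exp_sum chi \<xi> c d * twisted_exp \<xi> (c * d) ^ w"
      unfolding periodic' twisted_exp_sum_altdef
      by (simp add: twisted_exp_power distrib_left twisted_exp_add sum_distrib_right mult.assoc)
    finally show ?case
      using Suc.IH by (simp add: distrib_left)
  qed
  moreover have "(\<Sum>j<w. twisted_exp \<xi> (c * d) ^ j) * (twisted_exp \<xi> (c * d) - 1) =
                 twisted_exp \<xi> (c * d * w) - 1"
    using power_diff_1_eq[of "twisted_exp \<xi> (c * d)" w] by (simp add: twisted_exp_power mult.commute)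
  ultimately show ?thesis
    by (simp add: mult.assoc)
qed

lemma scaled_bernoulli_fps_mult_denominator:
  assumes "d > 0" and "\<xi> \<noteq> 0"
  shows "scaled_bernoulli_fps d chi \<xi> w * (twisted_exp \<xi> (w * d) - 1) =
         fps_const (of_nat w) * fps_X * twisted_exp_sum chi \<xi> w d"
proof -
  let ?c = "fps_const (of_nat w :: 'a) * fps_X"
  have "(twisted_bernoulli_fps d chi (\<xi> ^ w) *
           (fps_const ((\<xi> ^ w) ^ d) * fps_exp (of_nat d) - 1)) oo ?c =
        (fps_X * (\<Sum>a=0..<d. fps_const (chi (int a) * (\<xi> ^ w) ^ a) * fps_exp (of_nat a))) oo ?c"
    using twisted_bernoulli_fps_mult_denominator[of d "\<xi> ^ w" chi] assms by simp
  then show ?thesis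
    by (simp add: fps_compose_mult_distrib fps_compose_sub_distrib fps_compose_sum_distrib
        fps_exp_compose_linear scaled_bernoulli_fps_def twisted_exp_def twisted_exp_sum_def
        mult.left_commute[of fps_X] mult.assoc del: fps_const_mult flip: power_mult)
qed

lemma scaled_bernoulli_fps_mult_twisted_exp_sum_commute:
  fixes \<xi> :: "'a :: field_char_0"
  assumes "d > 0" and "w1 > 0" and "w2 > 0" and "\<xi> \<noteq> 0"
    and "\<And>a. chi (a + int d) = chi a"
  shows "fps_const (of_nat w2) * scaled_bernoulli_fps d chi \<xi> w1 * twisted_exp_sum chi \<xi> w2 (d * w1) =
         fps_const (of_nat w1) * scaled_bernoulli_fps d chi \<xi> w2 * twisted_exp_sum chi \<xi> w1 (d * w2)"
    (is "?l = ?r")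
proof -
  define D1 D2 where "D1 = twisted_exp \<xi> (w1 * d) - 1" and "D2 = twisted_exp \<xi> (w2 * d) - 1"
  define D12 where "D12 = twisted_exp \<xi> (w1 * w2 * d) - 1"
  have nz: "D1 * D2 \<noteq> 0"
    unfolding D1_def D2_def using assms
    by (metis mult_eq_0_iff nat_0_less_mult_iff twisted_exp_neq_1)
  have F1: "scaled_bernoulli_fps d chi \<xi> w1 * D1 =
              fps_const (of_nat w1) * fps_X * twisted_exp_sum chi \<xi> w1 d"
    and F2: "scaled_bernoulli_fps d chi \<xi> w2 * D2 =
              fps_const (of_nat w2) * fps_X * twisted_exp_sum chi \<xi> w2 d"
    unfolding D1_def D2_def using assms by (intro scaled_bernoulli_fps_mult_denominator; simp)+
  have A2: "twisted_exp_sum chi \<xi> w2 (d * w1) * D2 = twisted_exp_sum chi \<xi> w2 d * D12"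
    using twisted_exp_sum_mult_period[of chi d \<xi> w2 w1] assms(5)
    by (simp add: D2_def D12_def mult_ac)
  have A1: "twisted_exp_sum chi \<xi> w1 (d * w2) * D1 = twisted_exp_sum chi \<xi> w1 d * D12"
    using twisted_exp_sum_mult_period[of chi d \<xi> w1 w2] assms(5)
    by (simp add: D1_def D12_def mult_ac)
  have "?l * (D1 * D2) = fps_const (of_nat w2) * (scaled_bernoulli_fps d chi \<xi> w1 * D1) *
          (twisted_exp_sum chi \<xi> w2 (d * w1) * D2)"
    by (simp only: mult_ac)
  also have "\<dots> = fps_const (of_nat w1) * (scaled_bernoulli_fps d chi \<xi> w2 * D2) *
          (twisted_exp_sum chi \<xi> w1 (d * w2) * D1)"
    unfolding F1 F2 A1 A2 by (simp only: mult_ac)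
  also have "\<dots> = ?r * (D1 * D2)"
    by (simp only: mult_ac)
  finally show ?thesis
    using nz by (metis mult_right_cancel)
qed

text \<open>
  The factor \<open>w\<^bsup>k\<^esup>\<close> comes from the substitution of \<open>wt\<close> for \<open>t\<close>, which also turns \<open>e\<^bsup>xt\<^esup>\<close> into
  \<open>e\<^bsup>wxt\<^esup>\<close>; for \<open>x = (w2 / w1) i\<close> and \<open>w = w1\<close> the exponent becomes the integer multiple \<open>w2 i\<close> of \<open>t\<close>.
\<close>

lemma power_mult_twisted_bernoulli_poly:
  "of_nat w ^ k * twisted_bernoulli_poly d chi (\<xi> ^ w) m k x =
   fact k * fps_nth (scaled_bernoulli_fps d chi \<xi> w ^ m * fps_exp (of_nat w * x)) k"
proof -
  have "scaled_bernoulli_fps d chi \<xi> w ^ m * fps_exp (of_nat w * x) =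
        (twisted_bernoulli_fps d chi (\<xi> ^ w) ^ m * fps_exp x) oo (fps_const (of_nat w) * fps_X)"
    by (simp add: scaled_bernoulli_fps_def fps_compose_mult_distrib fps_compose_power
        fps_exp_compose_linear)
  then show ?thesis
    by (simp add: twisted_bernoulli_poly_def fps_compose_linear)
qed

lemma bernoulli_convolution:
  fixes \<xi> :: "'a :: field_char_0"
  assumes "w1 > 0"
  shows
    "(\<Sum>k=0..n. of_nat (n choose k) * of_nat w1 powi (int k - 1) * of_nat w2 ^ (n - k)
        * twisted_bernoulli_number d chi (\<xi> ^ w2) l (n - k)
        * (\<Sum>i=0..<N. chi (int i) * \<xi> ^ (w2 * i)
            * twisted_bernoulli_poly d chi (\<xi> ^ w1) m k (of_nat w2 / of_nat w1 * of_nat i)))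
     = fact n / of_nat w1 * fps_nth (scaled_bernoulli_fps d chi \<xi> w1 ^ m *
         twisted_exp_sum chi \<xi> w2 N * scaled_bernoulli_fps d chi \<xi> w2 ^ l) n"
    (is "?lhs = _ * fps_nth (?P * ?Q) n")
proof -
  have P: "fact k * fps_nth ?P k = of_nat w1 ^ k * (\<Sum>i=0..<N. chi (int i) * \<xi> ^ (w2 * i)
             * twisted_bernoulli_poly d chi (\<xi> ^ w1) m k (of_nat w2 / of_nat w1 * of_nat i))"
    (is "_ = _ * ?S k") for k
  proof -
    have "of_nat w1 ^ k * ?S k = (\<Sum>i=0..<N. chi (int i) * \<xi> ^ (w2 * i) * (of_nat w1 ^ k
             * twisted_bernoulli_poly d chi (\<xi> ^ w1) m k (of_nat w2 / of_nat w1 * of_nat i)))"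
      by (simp add: sum_distrib_left mult_ac)
    also have "\<dots> = (\<Sum>i=0..<N. fact k * fps_nth (scaled_bernoulli_fps d chi \<xi> w1 ^ m *
                 (fps_const (chi (int i) * \<xi> ^ (w2 * i)) * fps_exp (of_nat (w2 * i)))) k)"
      unfolding power_mult_twisted_bernoulli_poly using assms
      by (intro sum.cong refl) (simp add: mult.left_commute[of _ "fps_const _"] del: fps_const_mult)
    also have "\<dots> = fact k * fps_nth ?P k"
      by (simp add: twisted_exp_sum_def sum_distrib_left fps_sum_nth)
    finally show ?thesis ..
  qed
  have Q: "fact k * fps_nth ?Q k = of_nat w2 ^ k * twisted_bernoulli_number d chi (\<xi> ^ w2) l k" for k
    unfolding twisted_bernoulli_number_def power_mult_twisted_bernoulli_poly by simp
  have "?lhs = (\<Sum>k=0..n. of_nat (n choose k) / of_nat w1 *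
                  (fact k * fps_nth ?P k) * (fact (n - k) * fps_nth ?Q (n - k)))"
    unfolding P Q using assms by (intro sum.cong refl) (simp add: power_int_diff mult_ac)
  also have "\<dots> = (\<Sum>k=0..n. fact n / of_nat w1 * (fps_nth ?P k * fps_nth ?Q (n - k)))"
    by (intro sum.cong refl) (simp add: binomial_fact)
  finally show ?thesis
    by (simp add: fps_mult_nth sum_distrib_left)
qed

theorem corollary4:
  fixes p d w1 w2 n m :: nat
    and abv :: "'a :: field_char_0 \<Rightarrow> real"
    and chi :: "int \<Rightarrow> 'a" and \<xi> :: 'a
  assumes "prime p"
    and "p_adic_complex_field p abv"
    and "d \<ge> 1" and "w1 \<ge> 1" and "w2 \<ge> 1"
    and "dirichlet_character_with_conductor d chi"
    and "\<xi> \<in> p_power_roots_of_unity p"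
    and "m \<ge> 1"
  shows
    "(\<Sum>k=0..n. of_nat (n choose k) * of_nat w1 powi (int k - 1) * of_nat w2 ^ (n - k)
        * twisted_bernoulli_number d chi (\<xi> ^ w2) (m - 1) (n - k)
        * (\<Sum>i=0..<d*w1. chi (int i) * \<xi> ^ (w2 * i)
            * twisted_bernoulli_poly d chi (\<xi> ^ w1) m k (of_nat w2 / of_nat w1 * of_nat i)))
   = (\<Sum>k=0..n. of_nat (n choose k) * of_nat w2 powi (int k - 1) * of_nat w1 ^ (n - k)
        * twisted_bernoulli_number d chi (\<xi> ^ w1) (m - 1) (n - k)
        * (\<Sum>i=0..<d*w2. chi (int i) * \<xi> ^ (w1 * i)
            * twisted_bernoulli_poly d chi (\<xi> ^ w2) m k (of_nat w1 / of_nat w2 * of_nat i)))"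
proof -
  let ?F = "scaled_bernoulli_fps d chi \<xi>" and ?A = "twisted_exp_sum chi \<xi>"
  have pos: "d > 0" "w1 > 0" "w2 > 0"
    using assms by auto
  have periodic: "chi (a + int d) = chi a" for a
    using assms by (simp add: dirichlet_character_with_conductor_def dirichlet_character_def)
  have "\<xi> \<noteq> 0"
    using assms(7) prime_gt_0_nat[OF assms(1)]
    by (auto simp: p_power_roots_of_unity_def power_0_left)
  obtain l where l: "m = Suc l"
    using assms by (cases m) auto
  have "fps_const (of_nat w2) * (?F w1 ^ m * ?A w2 (d * w1) * ?F w2 ^ l) =
        (fps_const (of_nat w2) * ?F w1 * ?A w2 (d * w1)) * (?F w1 ^ l * ?F w2 ^ l)"
    by (simp add: l mult_ac)
  also have "\<dots> = (fps_const (of_nat w1) * ?F w2 * ?A w1 (d * w2)) * (?F w1 ^ l * ?F w2 ^ l)"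
    using scaled_bernoulli_fps_mult_twisted_exp_sum_commute
      [where chi = chi, OF pos \<open>\<xi> \<noteq> 0\<close> periodic] by simp
  also have "\<dots> = fps_const (of_nat w1) * (?F w2 ^ m * ?A w1 (d * w2) * ?F w1 ^ l)"
    by (simp add: l mult_ac)
  finally have "of_nat w2 * fps_nth (?F w1 ^ m * ?A w2 (d * w1) * ?F w2 ^ l) n =
                of_nat w1 * fps_nth (?F w2 ^ m * ?A w1 (d * w2) * ?F w1 ^ l) n"
    by (metis fps_mult_left_const_nth)
  then have "fact n / of_nat w1 * fps_nth (?F w1 ^ m * ?A w2 (d * w1) * ?F w2 ^ l) n =
             fact n / of_nat w2 * fps_nth (?F w2 ^ m * ?A w1 (d * w2) * ?F w1 ^ l) n"
    using pos by (simp add: field_simps)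
  then show ?thesis
    unfolding bernoulli_convolution[OF pos(2)] bernoulli_convolution[OF pos(3)]
    by (simp add: l)
qed

end
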